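(* Let $g,f,d_s,\kappa,p>0$, $s>1$ and $\tau^*_{cr}\ge 0$ be constants, and let the bedload transport rate be $$q_b=\kappa(\tau^*_b-\tau^*_{cr})^p\sqrt{(s-1)g d_s^3},\qquad \tau^*_b=\frac{f u^2}{8(s-1)g d_s}.$$ Define the constants $$u_{cr}^2=\tau^*_{cr}\Big[\frac{f}{8(s-1)g d_s}\Big]^{-1},\qquad A=\kappa\Big[\frac{f}{8(s-1)g d_s}\Big]^{p}\sqrt{(s-1)g d_s^3}.$$ Let $q$ be a given uniform discharge (a constant, independent of $x$ and $t$), let $\alpha,\beta,C\in\mathbb{R}$ be constants, and let $I\subseteq\mathbb{R}$ be an open interval on which $\alpha x+\beta>0$ (equivalently, on which $\tau^*_b>\tau^*_{cr}$ for the velocity $u$ defined below). For $x\in I$ and $t\in\mathbb{R}$ set $$u_e^2(x)=\Big[\frac{\alpha x+\beta}{A}\Big]^{1/p},\qquad u(x)=\sqrt{u_e^2(x)+u_{cr}^2},\qquad h(x)=\frac{q}{u(x)},$$ $$z_b^0(x)=-\frac{u(x)^3+2gq}{2g\,u(x)}+C,\qquad z_b(x,t)=-\alpha t+z_b^0(x).$$ Then $(h,u,z_b)$ is a smooth solution, with $hu=q$, on $I\times\mathbb{R}$ of the system $$\partial_t h+\partial_x(hu)=0,$$ $$\partial_t(hu)+\partial_x\big(hu^2+gh^2/2\big)+gh\,\partial_x z_b=0,$$ $$\partial_t z_b+\partial_x q_b=0.$$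
   Context: The system is the one-dimensional Shallow Water system coupled to the Exner equation: $h$ is the water depth, $u$ the flow velocity, $q=hu$ the water discharge, $z_b$ the thickness of the sediment layer, $g$ the acceleration due to gravity, and $q_b$ the volumetric bedload sediment transport rate. $\tau^*_b$ is the dimensionless bottom shear stress given by the Darcy-Weisbach friction law, with $f$ the friction coefficient, $s$ the relative density of sediment in water and $d_s$ the sediment diameter; $\tau^*_{cr}$ is the threshold for erosion, $\kappa$ an empirical coefficient and $p$ an exponent. The effective velocity $u_e$ is defined by $u_e^2=u^2-u_{cr}^2$, so that $q_b=A\,(u_e^2)^{p}=A\,u_e^{2p}$. "Smooth solution" means that the functions are smooth and the equations hold pointwise. *)

theory Defs
  imports "HOL-Analysis.Analysis"
begin

(* C^k and C^infinity functions on an open set S: S has to be open, since differentiability is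
   required with respect to full neighbourhoods of the points of S. *)

primrec C_k_on :: "nat \<Rightarrow> ('a::real_normed_vector \<Rightarrow> 'b::real_normed_vector) \<Rightarrow> 'a set \<Rightarrow> bool" where
  "C_k_on 0 F S \<longleftrightarrow> continuous_on S F"
| "C_k_on (Suc k) F S \<longleftrightarrow>
     (\<forall>x\<in>S. F differentiable (at x)) \<and>
     (\<forall>v. C_k_on k (\<lambda>x. frechet_derivative F (at x) v) S)"

definition smooth_on :: "('a::real_normed_vector \<Rightarrow> 'b::real_normed_vector) \<Rightarrow> 'a set \<Rightarrow> bool" where
  "smooth_on F S \<longleftrightarrow> (\<forall>k. C_k_on k F S)"

(* Smooth solutions (h, u, z) of the Shallow Water-Exner system on an open set S of points (x, t).
   The bedload transport rate is a closure law qb = qb(u).  In each equation the existence of the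
   partial derivatives is part of the claim; this matters for qb, which need not be differentiable
   at the threshold of erosion. *)

definition mass_eq_at :: "(real \<Rightarrow> real \<Rightarrow> real) \<Rightarrow> (real \<Rightarrow> real \<Rightarrow> real) \<Rightarrow> real \<Rightarrow> real \<Rightarrow> bool" where
  "mass_eq_at h u x t \<longleftrightarrow>
     (\<exists>ht qx. ((\<lambda>t'. h x t') has_real_derivative ht) (at t) \<and>
              ((\<lambda>x'. h x' t * u x' t) has_real_derivative qx) (at x) \<and>
              ht + qx = 0)"

definition momentum_eq_at ::
  "real \<Rightarrow> (real \<Rightarrow> real \<Rightarrow> real) \<Rightarrow> (real \<Rightarrow> real \<Rightarrow> real) \<Rightarrow> (real \<Rightarrow> real \<Rightarrow> real) \<Rightarrow> real \<Rightarrow> real \<Rightarrow> bool" where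
  "momentum_eq_at g h u z x t \<longleftrightarrow>
     (\<exists>qt Fx zx. ((\<lambda>t'. h x t' * u x t') has_real_derivative qt) (at t) \<and>
                 ((\<lambda>x'. h x' t * (u x' t)\<^sup>2 + g * (h x' t)\<^sup>2 / 2) has_real_derivative Fx) (at x) \<and>
                 ((\<lambda>x'. z x' t) has_real_derivative zx) (at x) \<and>
                 qt + Fx + g * h x t * zx = 0)"

definition exner_eq_at ::
  "(real \<Rightarrow> real) \<Rightarrow> (real \<Rightarrow> real \<Rightarrow> real) \<Rightarrow> (real \<Rightarrow> real \<Rightarrow> real) \<Rightarrow> real \<Rightarrow> real \<Rightarrow> bool" where
  "exner_eq_at qb u z x t \<longleftrightarrow>
     (\<exists>zt qbx. ((\<lambda>t'. z x t') has_real_derivative zt) (at t) \<and>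
               ((\<lambda>x'. qb (u x' t)) has_real_derivative qbx) (at x) \<and>
               zt + qbx = 0)"

definition smooth_SWE_solution ::
  "real \<Rightarrow> (real \<Rightarrow> real) \<Rightarrow> (real \<times> real) set \<Rightarrow>
   (real \<Rightarrow> real \<Rightarrow> real) \<Rightarrow> (real \<Rightarrow> real \<Rightarrow> real) \<Rightarrow> (real \<Rightarrow> real \<Rightarrow> real) \<Rightarrow> bool" where
  "smooth_SWE_solution g qb S h u z \<longleftrightarrow>
     smooth_on (\<lambda>(x, t). h x t) S \<and>
     smooth_on (\<lambda>(x, t). u x t) S \<and>
     smooth_on (\<lambda>(x, t). z x t) S \<and>
     (\<forall>(x, t)\<in>S. mass_eq_at h u x t \<and> momentum_eq_at g h u z x t \<and> exner_eq_at qb u z x t)"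

end

theory Submission
  imports Defs
begin

text \<open>
  On \<open>I\<close> the effective velocity makes the closure law collapse to the affine function
  \<open>q_b (u x) = A * ue2 x powr p = \<alpha> * x + \<beta>\<close>, which balances \<open>\<partial>\<^sub>t z_b = - \<alpha>\<close>. Moreover
  \<open>z0 = C - u\<^sup>2 / (2 * g) - h\<close>, so that with \<open>h * u = q\<close> constant the momentum equation is
  Bernoulli's law. For smoothness, everything is built from affine functions by sums, products
  and real powers of positive functions, since \<open>sqrt\<close> and \<open>inverse\<close> are such powers too.
\<close>

section \<open>Closure properties of smooth functions\<close>

text \<open>Since \<open>S\<close> is open, agreement on \<open>S\<close> forces equal derivatives
  at its points. \<open>F\<close> and \<open>G\<close> vary in the induction because the step passes
  to directional derivatives.\<close>

lemma C_k_on_cong: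
  assumes "open S" "\<And>x. x \<in> S \<Longrightarrow> F x = G x" "C_k_on k F S"
  shows "C_k_on k G S"
  using assms(2,3)
proof (induction k arbitrary: F G)
  case 0
  then show ?case
    using continuous_on_cong[of S S F G] by simp
next
  case (Suc k)
  have FG: "(G has_derivative frechet_derivative F (at x)) (at x)" if "x \<in> S" for x
  proof (rule has_derivative_transform_within_open[OF _ assms(1) that])
    show "(F has_derivative frechet_derivative F (at x)) (at x)"
      using Suc.prems(2) that by (simp add: frechet_derivative_works)
  qed (rule Suc.prems(1))
  then have eq: "frechet_derivative F (at x) = frechet_derivative G (at x)" if "x \<in> S" for x
    using that by (blast intro: frechet_derivative_at)
  have "C_k_on k (\<lambda>x. frechet_derivative G (at x) v) S" for v
    by (rule Suc.IH[of "\<lambda>x. frechet_derivative F (at x) v"]) (use eq Suc.prems(2) in simp_all)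
  moreover have "G differentiable (at x)" if "x \<in> S" for x
    using FG[OF that] by (rule differentiableI)
  ultimately show ?case
    by simp
qed

text \<open>By uniqueness of the derivative, any explicit formula \<open>F'\<close> can stand in for
  the abstractly chosen \<open>frechet_derivative\<close>.\<close>

lemma C_k_on_SucI:
  assumes "open S" "\<And>x. x \<in> S \<Longrightarrow> (F has_derivative F' x) (at x)"
    and "\<And>v. C_k_on k (\<lambda>x. F' x v) S"
  shows "C_k_on (Suc k) F S"
proof -
  have "F' x = frechet_derivative F (at x)" if "x \<in> S" for x
    using assms(2)[OF that] by (rule frechet_derivative_at)
  then have "C_k_on k (\<lambda>x. frechet_derivative F (at x) v) S" for v
    by (intro C_k_on_cong[OF assms(1) _ assms(3)[of v]]) simp
  moreover have "F differentiable (at x)" if "x \<in> S" for x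
    using assms(2)[OF that] by (rule differentiableI)
  ultimately show ?thesis
    by simp
qed

lemma C_k_on_SucD:
  assumes "C_k_on (Suc k) F S"
  shows "x \<in> S \<Longrightarrow> (F has_derivative frechet_derivative F (at x)) (at x)"
    and "C_k_on k (\<lambda>x. frechet_derivative F (at x) v) S"
  using assms by (auto simp: frechet_derivative_works)

text \<open>The product and chain rules leave undifferentiated factors in the derivative; this
  lowers their order to that of the induction hypothesis.\<close>

lemma C_k_on_Suc_imp: "C_k_on (Suc k) F S \<Longrightarrow> C_k_on k F S"
proof (induction k arbitrary: F)
  case 0
  then show ?case
    by (auto intro!: continuous_at_imp_continuous_on differentiable_imp_continuous_within)
next
  case (Suc k)
  then show ?case
    by simp
qed

lemma C_k_on_const: "open S \<Longrightarrow> C_k_on k (\<lambda>x. c) S"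
proof (induction k arbitrary: c)
  case (Suc k)
  show ?case
    by (rule C_k_on_SucI[where F' = "\<lambda>x v. 0"]) (use Suc in auto)
qed simp

lemma C_k_on_bounded_linear:
  assumes "open S" "bounded_linear L"
  shows "C_k_on k L S"
proof (cases k)
  case 0
  then show ?thesis
    using assms(2) by (simp add: linear_continuous_on)
next
  case (Suc n)
  show ?thesis
    unfolding Suc
    by (rule C_k_on_SucI[where F' = "\<lambda>x. L"])
      (use assms in \<open>auto intro: C_k_on_const bounded_linear_imp_has_derivative\<close>)
qed

lemma C_k_on_add:
  assumes "open S" "C_k_on k F S" "C_k_on k G S"
  shows "C_k_on k (\<lambda>x. F x + G x) S"
  using assms(2,3)
proof (induction k arbitrary: F G)
  case 0
  then show ?case
    by (simp add: continuous_on_add)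
next
  case (Suc k)
  note S = C_k_on_SucD[OF Suc.prems(1)] C_k_on_SucD[OF Suc.prems(2)]
  show ?case
    by (rule C_k_on_SucI[OF assms(1) has_derivative_add[OF S(1,3)]])
      (assumption | rule Suc.IH S)+
qed

lemma C_k_on_mult:
  fixes F G :: "'a::real_normed_vector \<Rightarrow> 'b::real_normed_algebra"
  assumes "open S" "C_k_on k F S" "C_k_on k G S"
  shows "C_k_on k (\<lambda>x. F x * G x) S"
  using assms(2,3)
proof (induction k arbitrary: F G)
  case 0
  then show ?case
    by (simp add: continuous_on_mult)
next
  case (Suc k)
  note S = C_k_on_SucD[OF Suc.prems(1)] C_k_on_SucD[OF Suc.prems(2)]
  show ?case
    by (rule C_k_on_SucI[OF assms(1) has_derivative_mult[OF S(1,3)]])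
      (assumption | rule C_k_on_add Suc.IH Suc.prems[THEN C_k_on_Suc_imp] S assms(1))+
qed

text \<open>The exponent varies in the induction: the derivative contains the power with exponent
  \<open>a - 1\<close> of the same positive base.\<close>

lemma C_k_on_powr:
  fixes F :: "'a::real_normed_vector \<Rightarrow> real"
  assumes "open S" "C_k_on k F S" "\<And>x. x \<in> S \<Longrightarrow> F x > 0"
  shows "C_k_on k (\<lambda>x. F x powr a) S"
  using assms(2)
proof (induction k arbitrary: a)
  case 0
  then show ?case
    using assms(3) by (fastforce intro!: continuous_on_powr)
next
  case (Suc k)
  note S = C_k_on_SucD[OF Suc.prems]
  have "((\<lambda>x. F x powr a) has_derivative
      (\<lambda>v. a * F x powr (a - 1) * frechet_derivative F (at x) v)) (at x)" if "x \<in> S" for x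
    using has_derivative_compose[OF S(1)[OF that]
        has_real_derivative_powr[OF assms(3)[OF that], of a, THEN has_field_derivative_imp_has_derivative]]
    by simp
  then show ?case
    by (rule C_k_on_SucI[OF assms(1)])
      (assumption | rule C_k_on_mult C_k_on_const Suc.IH Suc.prems[THEN C_k_on_Suc_imp] S(2) assms(1))+
qed

lemma smooth_on_cong:
  "smooth_on F S \<Longrightarrow> open S \<Longrightarrow> (\<And>x. x \<in> S \<Longrightarrow> G x = F x) \<Longrightarrow> smooth_on G S"
  unfolding smooth_on_def by (auto intro: C_k_on_cong[of S F G])

lemma smooth_on_const: "open S \<Longrightarrow> smooth_on (\<lambda>x. c) S"
  by (simp add: smooth_on_def C_k_on_const)

lemma smooth_on_bounded_linear: "open S \<Longrightarrow> bounded_linear L \<Longrightarrow> smooth_on L S"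
  by (simp add: smooth_on_def C_k_on_bounded_linear)

lemma smooth_on_add:
  "open S \<Longrightarrow> smooth_on F S \<Longrightarrow> smooth_on G S \<Longrightarrow> smooth_on (\<lambda>x. F x + G x) S"
  by (simp add: smooth_on_def C_k_on_add)

lemma smooth_on_mult:
  fixes F G :: "'a::real_normed_vector \<Rightarrow> 'b::real_normed_algebra"
  shows "open S \<Longrightarrow> smooth_on F S \<Longrightarrow> smooth_on G S \<Longrightarrow> smooth_on (\<lambda>x. F x * G x) S"
  by (simp add: smooth_on_def C_k_on_mult)

lemma smooth_on_powr:
  fixes F :: "'a::real_normed_vector \<Rightarrow> real"
  shows "open S \<Longrightarrow> smooth_on F S \<Longrightarrow> (\<And>x. x \<in> S \<Longrightarrow> F x > 0) \<Longrightarrow> smooth_on (\<lambda>x. F x powr a) S"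
  by (simp add: smooth_on_def C_k_on_powr)

section \<open>The steady flow over an eroding bed\<close>

theorem proposition2p1:
  fixes g f d_s \<kappa> p s \<tau>_cr q \<alpha> \<beta> C ucr2 A :: real
    and I :: "real set"
    and \<tau>_b q_b ue2 u h z0 :: "real \<Rightarrow> real"
    and z_b :: "real \<Rightarrow> real \<Rightarrow> real"
  assumes "g > 0" and "f > 0" and "d_s > 0" and "\<kappa> > 0" and "p > 0"
    and "s > 1" and "\<tau>_cr \<ge> 0"
    and \<tau>_b: "\<tau>_b = (\<lambda>v. f * v\<^sup>2 / (8 * (s - 1) * g * d_s))"
    and q_b: "q_b = (\<lambda>v. \<kappa> * (\<tau>_b v - \<tau>_cr) powr p * sqrt ((s - 1) * g * d_s ^ 3))"
    and ucr2: "ucr2 = \<tau>_cr * inverse (f / (8 * (s - 1) * g * d_s))"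
    and A: "A = \<kappa> * (f / (8 * (s - 1) * g * d_s)) powr p * sqrt ((s - 1) * g * d_s ^ 3)"
    and "open I" and "is_interval I"
    and pos: "\<And>x. x \<in> I \<Longrightarrow> \<alpha> * x + \<beta> > 0"
    and ue2: "ue2 = (\<lambda>x. ((\<alpha> * x + \<beta>) / A) powr (1 / p))"
    and u: "u = (\<lambda>x. sqrt (ue2 x + ucr2))"
    and h: "h = (\<lambda>x. q / u x)"
    and z0: "z0 = (\<lambda>x. - ((u x ^ 3 + 2 * g * q) / (2 * g * u x)) + C)"
    and z_b: "z_b = (\<lambda>x t. - \<alpha> * t + z0 x)"
  shows "smooth_SWE_solution g q_b (I \<times> UNIV) (\<lambda>x t. h x) (\<lambda>x t. u x) z_b
       \<and> (\<forall>x\<in>I. h x * u x = q)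
       \<and> (\<forall>x. \<alpha> * x + \<beta> \<ge> 0 \<longrightarrow> (\<alpha> * x + \<beta> > 0 \<longleftrightarrow> \<tau>_b (u x) > \<tau>_cr))"
proof -

  \<comment> \<open>Algebra of the closure law\<close>
  define c where "c = f / (8 * (s - 1) * g * d_s)"
  define R where "R = sqrt ((s - 1) * g * d_s ^ 3)"
  have c: "c > 0" and R: "R > 0"
    using assms(1-6) by (auto simp: c_def R_def)
  have A_eq: "A = \<kappa> * c powr p * R"
    by (simp only: A c_def R_def)
  then have A_pos: "A > 0"
    using c R \<open>\<kappa> > 0\<close> by simp
  have "ucr2 = \<tau>_cr * inverse c"
    by (simp only: ucr2 c_def)
  \<comment> \<open>\<open>c\<close> is the coefficient of the squared velocity in
    \<open>\<tau>_b\<close>, so \<open>ucr2\<close> is the squared velocity at which the shear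
    stress reaches the threshold.\<close>
  then have ucr2_eq: "c * ucr2 = \<tau>_cr" and ucr2_nonneg: "ucr2 \<ge> 0"
    using c \<open>\<tau>_cr \<ge> 0\<close> by auto
  have ue2_nonneg: "ue2 x \<ge> 0" for x
    by (simp add: ue2)
  \<comment> \<open>This holds for every \<open>x\<close>, also outside \<open>I\<close>, because
    \<open>powr\<close> is never negative; the final equivalence relies on that.\<close>
  have \<tau>_b_u: "\<tau>_b (u x) = c * ue2 x + \<tau>_cr" for x
  proof -
    have "\<tau>_b (u x) = c * (u x)\<^sup>2"
      by (simp add: \<tau>_b c_def)
    also have "(u x)\<^sup>2 = ue2 x + ucr2"
      using ue2_nonneg[of x] ucr2_nonneg by (simp add: u)
    finally show ?thesis
      using ucr2_eq by (simp add: algebra_simps)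
  qed
  have ue2_pos: "ue2 x > 0" if "x \<in> I" for x
    using pos[OF that] A_pos by (simp add: ue2)
  have u_pos: "u x > 0" if "x \<in> I" for x
    using ue2_pos[OF that] ucr2_nonneg by (simp add: u)
  have hu: "h x * u x = q" if "x \<in> I" for x
    using u_pos[OF that] by (simp add: h)
  have q_b_u: "q_b (u x) = \<alpha> * x + \<beta>" if "x \<in> I" for x
  proof -
    have "q_b (u x) = \<kappa> * (c * ue2 x) powr p * R"
      by (simp add: q_b \<tau>_b_u R_def)
    also have "\<dots> = A * ue2 x powr p"
      using c ue2_nonneg[of x] by (simp add: A_eq powr_mult)
    also have "ue2 x powr p = (\<alpha> * x + \<beta>) / A"
      using pos[OF that] A_pos \<open>p > 0\<close> by (simp add: ue2 powr_powr)
    finally show ?thesis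
      using A_pos by simp
  qed
  have z0_eq: "z0 x = C - (u x)\<^sup>2 / (2 * g) - h x" if "x \<in> I" for x
    using u_pos[OF that] \<open>g > 0\<close> by (simp add: z0 h field_simps power2_eq_square power3_eq_cube)

  \<comment> \<open>Smoothness of depth, velocity and bed\<close>
  define S where "S = I \<times> (UNIV :: real set)"
  have S: "open S"
    using \<open>open I\<close> by (simp add: S_def open_Times)
  have "smooth_on (\<lambda>y. ((\<alpha> * fst y + \<beta>) * (1 / A)) powr (1 / p) + ucr2) S"
    using pos A_pos
    by (intro smooth_on_add smooth_on_powr smooth_on_mult smooth_on_const smooth_on_bounded_linear
        bounded_linear_fst S) (auto simp: S_def)
  then have "smooth_on (\<lambda>y. ue2 (fst y) + ucr2) S"
    by (simp add: ue2)
  \<comment> \<open>The radicand stays positive even if \<open>\<tau>_cr = 0\<close>, because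
    \<open>ue2\<close> is positive on \<open>I\<close>; the square root is thus smooth
    there.\<close>
  then have "smooth_on (\<lambda>y. (ue2 (fst y) + ucr2) powr (1 / 2)) S"
    using ue2_pos ucr2_nonneg by (intro smooth_on_powr S) (auto simp: S_def add_pos_nonneg)
  then have smooth_u: "smooth_on (\<lambda>y. u (fst y)) S"
    by (rule smooth_on_cong[OF _ S]) (use ue2_nonneg ucr2_nonneg in \<open>auto simp: u powr_half_sqrt\<close>)
  have "smooth_on (\<lambda>y. q * u (fst y) powr (- 1)) S"
    using u_pos by (intro smooth_on_mult smooth_on_powr smooth_on_const smooth_u S) (auto simp: S_def)
  then have smooth_h: "smooth_on (\<lambda>y. h (fst y)) S"
    by (rule smooth_on_cong[OF _ S])
      (use u_pos in \<open>auto simp: h S_def powr_minus divide_inverse less_imp_le\<close>)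
  \<comment> \<open>Bernoulli form of the bed, with differences and the square rewritten as sums and
    products to fit the closure rules.\<close>
  have "smooth_on (\<lambda>y. - \<alpha> * snd y + (C + ((- 1 / (2 * g)) * (u (fst y) * u (fst y)) + (- 1) * h (fst y)))) S"
    by (intro smooth_on_add smooth_on_mult smooth_on_const smooth_on_bounded_linear
        bounded_linear_snd smooth_u smooth_h S)
  then have smooth_z: "smooth_on (\<lambda>y. z_b (fst y) (snd y)) S"
    by (rule smooth_on_cong[OF _ S]) (auto simp: z_b z0_eq S_def power2_eq_square)

  \<comment> \<open>The three equations at a point\<close>
  have equations: "mass_eq_at (\<lambda>x t. h x) (\<lambda>x t. u x) x t
      \<and> momentum_eq_at g (\<lambda>x t. h x) (\<lambda>x t. u x) z_b x t
      \<and> exner_eq_at q_b (\<lambda>x t. u x) z_b x t" if x: "x \<in> I" for x t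
  proof (intro conjI)
    \<comment> \<open>The simplified formulas are known only on \<open>I\<close>; as
      \<open>I\<close> is open, they may be differentiated in place of the original ones.\<close>
    have local_eq: "(G has_real_derivative D) (at x)"
      if "(F has_real_derivative D) (at x)" "\<And>y. y \<in> I \<Longrightarrow> F y = G y" for F G D
      using has_field_derivative_transform_within_open[OF that(1) \<open>open I\<close> x that(2)] .
    define D where "D = 1 / p * ((\<alpha> * x + \<beta>) / A) powr (1 / p - 1) * (\<alpha> / A)"
    have "(ue2 has_real_derivative D) (at x)"
      unfolding ue2 D_def using pos[OF x] A_pos
      by (auto intro!: derivative_eq_intros simp: powr_diff)
    then have "(u has_real_derivative D / (2 * u x)) (at x)"
      unfolding u using ue2_pos[OF x] ucr2_nonneg
      by (auto intro!: derivative_eq_intros simp: field_simps)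
    \<comment> \<open>From here on only the existence of the derivatives matters: \<open>U\<close>
      and \<open>H\<close> cancel from the momentum equation whatever their values.\<close>
    then obtain U where U: "(u has_real_derivative U) (at x)" ..
    have "((\<lambda>x. q / u x) has_real_derivative - q * U / (u x)\<^sup>2) (at x)"
      using u_pos[OF x]
      by (auto intro!: derivative_eq_intros U simp: power2_eq_square field_simps)
    then obtain H where H: "(h has_real_derivative H) (at x)"
      by (auto simp: h)
    have z0': "(z0 has_real_derivative - (u x * U / g) - H) (at x)"
    proof (rule local_eq)
      show "((\<lambda>x. C - (u x)\<^sup>2 / (2 * g) - h x) has_real_derivative - (u x * U / g) - H) (at x)"
        using \<open>g > 0\<close> by (auto intro!: derivative_eq_intros U H simp: field_simps)
    qed (simp add: z0_eq)
    show "mass_eq_at (\<lambda>x t. h x) (\<lambda>x t. u x) x t"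
      unfolding mass_eq_at_def
    proof (intro exI conjI)
      show "((\<lambda>x. h x * u x) has_real_derivative 0) (at x)"
        by (rule local_eq[OF DERIV_const]) (simp add: hu)
    qed simp_all
    show "momentum_eq_at g (\<lambda>x t. h x) (\<lambda>x t. u x) z_b x t"
      unfolding momentum_eq_at_def
    proof (intro exI conjI)
      show "((\<lambda>t'. h x * u x) has_real_derivative 0) (at t)"
        by simp
      show "((\<lambda>x. h x * (u x)\<^sup>2 + g * (h x)\<^sup>2 / 2) has_real_derivative q * U + g * h x * H) (at x)"
      proof (rule local_eq)
        show "((\<lambda>x. q * u x + g * (h x)\<^sup>2 / 2) has_real_derivative q * U + g * h x * H) (at x)"
          by (auto intro!: derivative_eq_intros U H)
      qed (simp add: power2_eq_square hu flip: mult.assoc)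
      show "((\<lambda>x. z_b x t) has_real_derivative - (u x * U / g) - H) (at x)"
        unfolding z_b by (auto intro!: derivative_eq_intros z0')
      \<comment> \<open>The depth terms cancel directly; the rest vanishes once \<open>q\<close> is
        replaced by \<open>h x * u x\<close>.\<close>
      show "0 + (q * U + g * h x * H) + g * h x * (- (u x * U / g) - H) = 0"
        using \<open>g > 0\<close> by (simp add: algebra_simps flip: hu[OF x])
    qed
    have "((\<lambda>x. q_b (u x)) has_real_derivative \<alpha>) (at x)"
    proof (rule local_eq)
      show "((\<lambda>x. \<alpha> * x + \<beta>) has_real_derivative \<alpha>) (at x)"
        by (auto intro!: derivative_eq_intros)
    qed (simp add: q_b_u)
    moreover have "((\<lambda>t. z_b x t) has_real_derivative - \<alpha>) (at t)"
      unfolding z_b by (auto intro!: derivative_eq_intros)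
    ultimately show "exner_eq_at q_b (\<lambda>x t. u x) z_b x t"
      unfolding exner_eq_at_def by (intro exI[of _ "- \<alpha>"] exI[of _ \<alpha>]) simp
  qed

  \<comment> \<open>In the boundary case the convention \<open>0 powr (1 / p) = 0\<close> gives
    \<open>ue2 x = 0\<close>, so the shear stress equals the threshold exactly.\<close>
  have "\<alpha> * x + \<beta> > 0 \<longleftrightarrow> \<tau>_b (u x) > \<tau>_cr" if "\<alpha> * x + \<beta> \<ge> 0" for x
    using that c A_pos by (auto simp: \<tau>_b_u zero_less_mult_iff ue2)
  with hu equations smooth_u smooth_h smooth_z show ?thesis
    by (auto simp: smooth_SWE_solution_def S_def case_prod_unfold)
qed

end
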